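(* Let $\Gamma$ be a locally finite graph, $F$ a field with an absolute value $|\cdot|_{\rm v}$, and $\lambda\in F$. Then the following conditions are equivalent: (i) $\lambda$ is not an eigenvalue of the adjacency operator $A_{\Gamma,F}$, i.e. the operator $A_{\Gamma,F}-\lambda E$ is injective. (ii) The operator $A_{\Gamma,F}-\lambda E$ is bijective. (iii) With respect to some vertex of $\Gamma$ there is a unique $(F,\lambda)$-propagator of $\Gamma$. (iv) $L_{F,\lambda}(\Gamma)=V(\Gamma)$. (v) With respect to every vertex $v$ the graph $\Gamma$ has a unique $(F,\lambda)$-propagator $p_v$, this propagator has finite support, and $p_{v_1}(v_2)=p_{v_2}(v_1)$ for all $v_1,v_2\in V(\Gamma)$ (in particular, each vertex of $\Gamma$ belongs to the supports of only finitely many of the propagators $p_u$, $u\in V(\Gamma)$). (vi) The matrix $\mathbf{A}_{\Gamma,F}-\lambda\mathbf{E}$ has an inverse (symmetric) matrix in the algebra $M^{rcf}_{V(\Gamma)\times V(\Gamma)}(F)$. (vii) The operator $A_{\Gamma,F}-\lambda E$ maps the subspace $F^{V(\Gamma)*}$ of $F^{V(\Gamma)}$ surjectively onto itself. (viii) The operator $A_{\Gamma,F}-\lambda E$ maps the subspace $F^{V(\Gamma)*}$ of $F^{V(\Gamma)}$ bijectively onto itself.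
   Context: A graph is an undirected graph without loops or multiple edges, with non-empty vertex set $V(\Gamma)$; $\Gamma(v)$ is the set of vertices adjacent to $v$. $\Gamma$ is locally finite if every $\Gamma(v)$ is finite (it may be infinite and disconnected). $F^{V(\Gamma)}$ is the $F$-vector space of all functions $V(\Gamma)\to F$, and $A_{\Gamma,F}:F^{V(\Gamma)}\to F^{V(\Gamma)}$ is the linear operator $(A_{\Gamma,F}(f))(v)=\sum_{u\in\Gamma(v)}f(u)$; $E$ is the identity operator. The absolute value may be trivial. The support of $f$ is $\{u: f(u)\neq 0\}$; $F^{V(\Gamma)*}$ is the subspace of functions with finite support. $\delta_v$ is the function equal to $1$ at $v$ and $0$ elsewhere. An $(F,\lambda)$-propagator of $\Gamma$ with respect to $v$ is any $f\in F^{V(\Gamma)}$ with $(A_{\Gamma,F}-\lambda E)(f)=\delta_v$. $L_{F,\lambda}(\Gamma)$ is the set of vertices with respect to which $\Gamma$ has an $(F,\lambda)$-propagator with finite support. $M^{rcf}_{V(\Gamma)\times V(\Gamma)}(F)$ is the associative $F$-algebra of matrices over $F$ with rows and columns indexed by $V(\Gamma)$ having only finitely many nonzero entries in each row and in each column. $\mathbf{A}_{\Gamma,F}$ is the $V(\Gamma)\times V(\Gamma)$ matrix whose $(u,v)$ entry is $1$ if $u,v$ are adjacent and $0$ otherwise; $\mathbf{E}$ is the identity matrix. *)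

theory Defs
  imports
    "HOL-Analysis.Elementary_Normed_Spaces"
    "Graph_Theory.Pair_Digraph"
begin

text \<open>
  A loopless undirected graph without multiple edges, possibly infinite, is a
  \<^locale>\<open>pair_bidirected_digraph\<close>: its arcs form a symmetric irreflexive relation on the vertex
  set. Adjacency of u and v is \<open>(u, v) \<in> parcs G\<close>.
\<close>

definition neighbours :: "'v pair_pre_digraph \<Rightarrow> 'v \<Rightarrow> 'v set" where
  "neighbours G v = {u. (v, u) \<in> parcs G}"

definition locally_finite_graph :: "'v pair_pre_digraph \<Rightarrow> bool" where
  "locally_finite_graph G \<longleftrightarrow>
     pair_bidirected_digraph G \<and> pverts G \<noteq> {} \<and> (\<forall>v\<in>pverts G. finite (neighbours G v))"

text \<open>The trivial absolute value is allowed.\<close>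

definition absolute_value :: "('f::field \<Rightarrow> real) \<Rightarrow> bool" where
  "absolute_value av \<longleftrightarrow>
     (\<forall>x. av x \<ge> 0) \<and> (\<forall>x. av x = 0 \<longleftrightarrow> x = 0) \<and>
     (\<forall>x y. av (x * y) = av x * av y) \<and> (\<forall>x y. av (x + y) \<le> av x + av y)"

text \<open>
  Functions on a vertex set V are represented by extensional functions, so that equality of
  representatives is equality on V.
\<close>

definition vertex_funs :: "'v set \<Rightarrow> ('v \<Rightarrow> 'f::field) set" where
  "vertex_funs V = V \<rightarrow>\<^sub>E UNIV"

definition fin_vertex_funs :: "'v set \<Rightarrow> ('v \<Rightarrow> 'f::field) set" where
  "fin_vertex_funs V = {f \<in> vertex_funs V. finite (support_on V f)}"

definition adj_op :: "'v pair_pre_digraph \<Rightarrow> ('v \<Rightarrow> 'f::field) \<Rightarrow> 'v \<Rightarrow> 'f" where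
  "adj_op G f = (\<lambda>v\<in>pverts G. \<Sum>u\<in>neighbours G v. f u)"

definition adj_op_minus :: "'v pair_pre_digraph \<Rightarrow> 'f::field \<Rightarrow> ('v \<Rightarrow> 'f) \<Rightarrow> 'v \<Rightarrow> 'f" where
  "adj_op_minus G lam f = (\<lambda>v\<in>pverts G. adj_op G f v - lam * f v)"

definition adj_eigenvalue :: "'v pair_pre_digraph \<Rightarrow> 'f::field \<Rightarrow> bool" where
  "adj_eigenvalue G lam \<longleftrightarrow>
     (\<exists>f\<in>vertex_funs (pverts G).
        f \<noteq> (\<lambda>v\<in>pverts G. 0) \<and> adj_op G f = (\<lambda>v\<in>pverts G. lam * f v))"

definition delta_fun :: "'v set \<Rightarrow> 'v \<Rightarrow> 'v \<Rightarrow> 'f::field" where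
  "delta_fun V v = (\<lambda>u\<in>V. if u = v then 1 else 0)"

definition propagator :: "'v pair_pre_digraph \<Rightarrow> 'f::field \<Rightarrow> 'v \<Rightarrow> ('v \<Rightarrow> 'f) \<Rightarrow> bool" where
  "propagator G lam v f \<longleftrightarrow>
     f \<in> vertex_funs (pverts G) \<and> adj_op_minus G lam f = delta_fun (pverts G) v"

definition fin_propagator_verts :: "'v pair_pre_digraph \<Rightarrow> 'f::field \<Rightarrow> 'v set" where
  "fin_propagator_verts G lam =
     {v \<in> pverts G. \<exists>f. propagator G lam v f \<and> finite (support_on (pverts G) f)}"

text \<open>Matrices with rows and columns indexed by V are extensional functions on \<open>V \<times> V\<close>.\<close>

definition rcf_mats :: "'v set \<Rightarrow> ('v \<times> 'v \<Rightarrow> 'f::field) set" where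
  "rcf_mats V = {M \<in> V \<times> V \<rightarrow>\<^sub>E UNIV.
     (\<forall>u\<in>V. finite {v \<in> V. M (u, v) \<noteq> 0}) \<and> (\<forall>v\<in>V. finite {u \<in> V. M (u, v) \<noteq> 0})}"

text \<open>
  The sum below runs over the indices with nonzero summand; for row- and column-finite
  factors there are only finitely many of them.
\<close>

definition mat_mul :: "'v set \<Rightarrow> ('v \<times> 'v \<Rightarrow> 'f::field) \<Rightarrow> ('v \<times> 'v \<Rightarrow> 'f) \<Rightarrow> 'v \<times> 'v \<Rightarrow> 'f" where
  "mat_mul V M N = (\<lambda>(u, w)\<in>V \<times> V. supp_sum (\<lambda>v. M (u, v) * N (v, w)) V)"

definition mat_id :: "'v set \<Rightarrow> 'v \<times> 'v \<Rightarrow> 'f::field" where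
  "mat_id V = (\<lambda>(u, v)\<in>V \<times> V. if u = v then 1 else 0)"

definition adj_mat :: "'v pair_pre_digraph \<Rightarrow> 'v \<times> 'v \<Rightarrow> 'f::field" where
  "adj_mat G = (\<lambda>(u, v)\<in>pverts G \<times> pverts G. if (u, v) \<in> parcs G then 1 else 0)"

definition adj_mat_minus :: "'v pair_pre_digraph \<Rightarrow> 'f::field \<Rightarrow> 'v \<times> 'v \<Rightarrow> 'f" where
  "adj_mat_minus G lam =
     (\<lambda>e\<in>pverts G \<times> pverts G. adj_mat G e - lam * mat_id (pverts G) e)"

definition rcf_inverse :: "'v set \<Rightarrow> ('v \<times> 'v \<Rightarrow> 'f::field) \<Rightarrow> ('v \<times> 'v \<Rightarrow> 'f) \<Rightarrow> bool" where
  "rcf_inverse V M B \<longleftrightarrow>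
     M \<in> rcf_mats V \<and> B \<in> rcf_mats V \<and> mat_mul V M B = mat_id V \<and> mat_mul V B M = mat_id V"

definition symmetric_mat :: "'v set \<Rightarrow> ('v \<times> 'v \<Rightarrow> 'f::field) \<Rightarrow> bool" where
  "symmetric_mat V M \<longleftrightarrow> (\<forall>u\<in>V. \<forall>v\<in>V. M (u, v) = M (v, u))"

end

theory Submission
  imports Defs "HOL-Library.Function_Algebras"
begin

text \<open>
  Write \<open>T\<close> for the operator \<open>A - \<lambda>E\<close>. It is multiplication by a symmetric matrix with finite
  rows, and the argument concerns such matrices in general. Three facts carry the proof.

  The bilinear pairing \<open>\<langle>f, g\<rangle> = (\<Sum>v. f v * g v)\<close> is defined whenever \<open>g\<close> has finite support; it
  identifies the space of all functions with the algebraic dual of the space of finitely supported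
  ones. By symmetry of the matrix \<open>\<langle>T f, g\<rangle> = \<langle>f, T g\<rangle>\<close> (\<open>pairing_mat_op\<close>), so \<open>T\<close> on all functions is
  the transpose of \<open>T\<close> on finitely supported functions.

  A transpose is injective only if the original map is surjective: if some unit vector \<open>\<delta>\<^sub>w\<close> were not
  \<open>T p\<close> for a finitely supported \<open>p\<close>, a linear functional would vanish on the image of \<open>T\<close> but not
  on \<open>\<delta>\<^sub>w\<close>, and its values on the unit vectors would form a nonzero function in the kernel of \<open>T\<close>
  (\<open>delta_fun_in_image\<close>). Injectivity alone thus gives finitely supported propagators \<open>p\<^sub>v\<close>
  for all vertices.

  Conversely, such a family \<open>p\<^sub>v\<close> inverts \<open>T\<close>. From \<open>f v = \<langle>f, T p\<^sub>v\<rangle> = \<langle>T f, p\<^sub>v\<rangle>\<close> every function is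
  recovered from its image, which gives injectivity and, applied to \<open>f = p\<^sub>u\<close>, the symmetry
  \<open>p\<^sub>u v = p\<^sub>v u\<close>; the same formula read as a definition, \<open>f v = \<langle>g, p\<^sub>v\<rangle>\<close>, solves \<open>T f = g\<close>
  (\<open>fin_green_solution\<close>) and preserves finite supports. Each of the listed conditions is therefore
  equivalent to the existence of the family \<open>p\<close>, whose members are the columns of the inverse matrix
  (\<open>rcf_inverse_iff_fin_green\<close>). A unique propagator for a single vertex suffices because adding an
  element of the kernel to it gives another one (\<open>inj_of_unique_preimage\<close>).
\<close>

section \<open>Separating a vector from a subspace\<close>

text \<open>
  Extend a basis of the subspace by the vector itself and prescribe the functional on this
  independent set.
\<close>

lemma (in vector_space) separating_functional:
  assumes "subspace S" and "x \<notin> S"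
  obtains \<phi> where "Vector_Spaces.linear scale (*) \<phi>" and "\<And>y. y \<in> S \<Longrightarrow> \<phi> y = 0" and "\<phi> x = 1"
proof -
  interpret scalars: vector_space "(*) :: 'a \<Rightarrow> 'a \<Rightarrow> 'a"
    by unfold_locales (auto simp: algebra_simps)
  interpret vector_space_pair scale "(*) :: 'a \<Rightarrow> 'a \<Rightarrow> 'a" ..
  obtain B where B: "B \<subseteq> S" "independent B" "S \<subseteq> span B"
    using maximal_independent_subset[of S] by blast
  have span_B: "span B = S"
    using B assms(1) span_minimal by blast
  have "independent (insert x B)"
    using independent_insertI[of x B] assms(2) B(2) span_B by blast
  then obtain \<phi> where lin: "Vector_Spaces.linear scale (*) \<phi>"
    and \<phi>: "\<forall>y\<in>insert x B. \<phi> y = (if y = x then 1 else 0)"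
    using linear_independent_extend[where f = "\<lambda>y. if y = x then 1 else 0"] by blast
  have "\<phi> y = 0" if "y \<in> B" for y
    using \<phi> that assms(2) B(1) by auto
  then have "\<phi> y = 0" if "y \<in> S" for y
    using linear_eq_0_on_span[OF lin, of B y] that span_B by auto
  with lin \<phi> show thesis
    using that by simp
qed

section \<open>Symmetric matrices with finite rows\<close>

lemma fun_sum_apply: "sum F A x = (\<Sum>i\<in>A. F i x)" for F :: "'i \<Rightarrow> 'a \<Rightarrow> 'b::comm_monoid_add"
  by (induction A rule: infinite_finite_induct) simp_all

lemma supp_sum_eq_sum:
  assumes "finite A" and "A \<subseteq> V" and "\<And>v. v \<in> V \<Longrightarrow> v \<notin> A \<Longrightarrow> f v = 0"
  shows "supp_sum f V = sum f A"
proof -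
  have "sum f (support_on V f) = sum f A"
    using assms by (intro sum.mono_neutral_left) (auto simp: in_support_on, blast)
  then show ?thesis
    by (simp add: supp_sum_def)
qed

lemma supp_sum_cong:
  assumes "\<And>v. v \<in> V \<Longrightarrow> f v = g v"
  shows "supp_sum f V = supp_sum g V"
  using assms by (auto simp: supp_sum_def support_on_def intro!: sum.cong)

definition mat_op :: "'v set \<Rightarrow> ('v \<times> 'v \<Rightarrow> 'f::field) \<Rightarrow> ('v \<Rightarrow> 'f) \<Rightarrow> 'v \<Rightarrow> 'f" where
  "mat_op V M f = (\<lambda>v\<in>V. supp_sum (\<lambda>u. M (v, u) * f u) V)"

definition pairing :: "'v set \<Rightarrow> ('v \<Rightarrow> 'f::field) \<Rightarrow> ('v \<Rightarrow> 'f) \<Rightarrow> 'f" where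
  "pairing V f g = supp_sum (\<lambda>v. f v * g v) V"

lemma fin_vertex_funsD:
  assumes "g \<in> fin_vertex_funs V"
  shows "finite {v \<in> V. g v \<noteq> 0}"
  using assms by (simp add: fin_vertex_funs_def support_on_def)

lemma fin_vertex_funsI:
  assumes "g \<in> vertex_funs V" and "finite {v \<in> V. g v \<noteq> 0}"
  shows "g \<in> fin_vertex_funs V"
  using assms by (simp add: fin_vertex_funs_def support_on_def)

lemma restrict_in_vertex_funs [simp]: "restrict f V \<in> vertex_funs V"
  by (simp add: vertex_funs_def)

lemma vertex_funs_eqI:
  assumes "f \<in> vertex_funs V" and "g \<in> vertex_funs V" and "\<And>v. v \<in> V \<Longrightarrow> f v = g v"
  shows "f = g"
  using assms unfolding vertex_funs_def by (rule PiE_ext)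

lemma delta_fun_fin [simp]: "delta_fun V v \<in> fin_vertex_funs V"
proof (rule fin_vertex_funsI)
  show "finite {u \<in> V. delta_fun V v u \<noteq> 0}"
    by (rule finite_subset[of _ "{v}"]) (auto simp: delta_fun_def)
qed (simp add: delta_fun_def)

lemma fin_vertex_funs_subset: "f \<in> fin_vertex_funs V \<Longrightarrow> f \<in> vertex_funs V"
  by (simp add: fin_vertex_funs_def)

lemma mat_op_in_vertex_funs [simp]: "mat_op V M f \<in> vertex_funs V"
  by (simp add: mat_op_def)

lemma pairing_commute: "pairing V f g = pairing V g f"
  by (simp add: pairing_def mult.commute)

lemma pairing_delta_fun: "v \<in> V \<Longrightarrow> pairing V f (delta_fun V v) = f v"
  unfolding pairing_def by (subst supp_sum_eq_sum[of "{v}"]) (auto simp: delta_fun_def)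

locale symmetric_row_finite =
  fixes V :: "'v set" and M :: "'v \<times> 'v \<Rightarrow> 'f::field"
  assumes row_finite: "v \<in> V \<Longrightarrow> finite {u \<in> V. M (v, u) \<noteq> 0}"
    and M_sym: "u \<in> V \<Longrightarrow> v \<in> V \<Longrightarrow> M (u, v) = M (v, u)"
begin

lemma mat_op_eq_sum:
  assumes "v \<in> V" and "finite A" and "A \<subseteq> V"
    and "\<And>u. u \<in> V \<Longrightarrow> u \<notin> A \<Longrightarrow> M (v, u) * f u = 0"
  shows "mat_op V M f v = (\<Sum>u\<in>A. M (v, u) * f u)"
  using assms by (simp add: mat_op_def supp_sum_eq_sum)

lemma mat_op_row_sum:
  assumes "v \<in> V"
  shows "mat_op V M f v = (\<Sum>u\<in>{u \<in> V. M (v, u) \<noteq> 0}. M (v, u) * f u)"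
  by (rule mat_op_eq_sum) (use assms row_finite in auto)

lemma mat_op_linear:
  assumes "v \<in> V"
  shows "mat_op V M (\<lambda>u\<in>V. a * f u + b * g u) v = a * mat_op V M f v + b * mat_op V M g v"
  by (simp add: mat_op_row_sum assms sum_distrib_left sum.distrib[symmetric] algebra_simps)

lemma mat_op_fin:
  assumes "f \<in> fin_vertex_funs V"
  shows "mat_op V M f \<in> fin_vertex_funs V"
proof (rule fin_vertex_funsI)
  let ?N = "\<Union>u\<in>{u \<in> V. f u \<noteq> 0}. {v \<in> V. M (u, v) \<noteq> 0}"
  have "mat_op V M f v = 0" if "v \<in> V" "v \<notin> ?N" for v
    using that M_sym by (subst mat_op_row_sum) (auto intro!: sum.neutral)
  then have "{v \<in> V. mat_op V M f v \<noteq> 0} \<subseteq> ?N"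
    by blast
  moreover have "finite ?N"
    using fin_vertex_funsD[OF assms] row_finite by auto
  ultimately show "finite {v \<in> V. mat_op V M f v \<noteq> 0}"
    by (rule finite_subset)
qed simp

text \<open>
  Both sides are the double sum of \<open>f u * M (u, v) * g v\<close>. It is finite because \<open>v\<close> ranges over
  the support of \<open>g\<close> and \<open>u\<close> over the finitely many nonzero places in these rows; the support
  of \<open>f\<close> may be infinite.
\<close>

lemma pairing_mat_op:
  assumes "g \<in> fin_vertex_funs V"
  shows "pairing V (mat_op V M f) g = pairing V f (mat_op V M g)"
proof -
  let ?S = "{v \<in> V. g v \<noteq> 0}"
  let ?N = "\<Union>v\<in>?S. {u \<in> V. M (v, u) \<noteq> 0}"
  have S: "finite ?S"
    using fin_vertex_funsD[OF assms] .
  have N: "finite ?N"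
    using S row_finite by auto
  have op_f: "mat_op V M f v = (\<Sum>u\<in>?N. M (v, u) * f u)" if "v \<in> ?S" for v
    using that N by (intro mat_op_eq_sum) auto
  have op_g: "mat_op V M g u = (\<Sum>v\<in>?S. M (u, v) * g v)" if "u \<in> V" for u
    using that S by (intro mat_op_eq_sum) auto
  have "pairing V (mat_op V M f) g = (\<Sum>v\<in>?S. mat_op V M f v * g v)"
    unfolding pairing_def using S by (intro supp_sum_eq_sum) auto
  also have "\<dots> = (\<Sum>v\<in>?S. \<Sum>u\<in>?N. f u * (M (u, v) * g v))"
    by (intro sum.cong refl) (auto simp: op_f sum_distrib_right M_sym intro!: sum.cong)
  also have "\<dots> = (\<Sum>u\<in>?N. f u * mat_op V M g u)"
    by (subst sum.swap) (auto simp: op_g sum_distrib_left intro!: sum.cong)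
  also have "\<dots> = pairing V f (mat_op V M g)"
    unfolding pairing_def using N
  proof (intro supp_sum_eq_sum[symmetric])
    fix u assume "u \<in> V" "u \<notin> ?N"
    then have "mat_op V M g u = 0"
      using M_sym by (subst op_g) (auto intro!: sum.neutral)
    then show "f u * mat_op V M g u = 0"
      by simp
  qed auto
  finally show ?thesis .
qed

section \<open>Finitely supported preimages of the unit vectors\<close>

text \<open>
  An injective transpose forces surjectivity: a functional \<open>\<phi>\<close> that vanishes on the image of the
  finitely supported functions is represented by the function \<open>u \<mapsto> \<phi> \<delta>\<^sub>u\<close>, which the operator
  annihilates since its value at \<open>v\<close> is \<open>\<phi>\<close> of column \<open>v\<close>.
\<close>

lemma delta_fun_in_image:
  assumes inj: "\<And>f. f \<in> vertex_funs V \<Longrightarrow> \<forall>v\<in>V. mat_op V M f v = 0 \<Longrightarrow> \<forall>v\<in>V. f v = 0"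
    and "w \<in> V"
  obtains p where "p \<in> fin_vertex_funs V" and "mat_op V M p = delta_fun V w"
proof (rule ccontr)
  assume "\<not> thesis"
  then have no_preimage: "\<not> (\<exists>p\<in>fin_vertex_funs V. mat_op V M p = delta_fun V w)"
    using that by blast
  define scale :: "'f \<Rightarrow> ('v \<Rightarrow> 'f) \<Rightarrow> 'v \<Rightarrow> 'f" where "scale c h = (\<lambda>u. c * h u)" for c h
  interpret vector_space scale
    by unfold_locales (auto simp: scale_def fun_eq_iff algebra_simps)
  (* The vector space lives on total functions, whose values outside V are arbitrary here; only
     the restrictions to V decide membership in S. *)
  define S where "S = {h. \<exists>p\<in>fin_vertex_funs V. mat_op V M p = restrict h V}"
  define e :: "'v \<Rightarrow> 'v \<Rightarrow> 'f" where "e v = (\<lambda>u. if u = v then 1 else 0)" for v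
  have comb: "\<exists>r\<in>fin_vertex_funs V. mat_op V M r = restrict (scale a h + scale b k) V"
    if "p \<in> fin_vertex_funs V" "q \<in> fin_vertex_funs V"
      "mat_op V M p = restrict h V" "mat_op V M q = restrict k V" for a b p q h k
  proof
    show "(\<lambda>u\<in>V. a * p u + b * q u) \<in> fin_vertex_funs V"
    proof (rule fin_vertex_funsI)
      have "{u \<in> V. (\<lambda>u\<in>V. a * p u + b * q u) u \<noteq> 0} \<subseteq> {u \<in> V. p u \<noteq> 0} \<union> {u \<in> V. q u \<noteq> 0}"
        by auto
      then show "finite {u \<in> V. (\<lambda>u\<in>V. a * p u + b * q u) u \<noteq> 0}"
        using fin_vertex_funsD[OF that(1)] fin_vertex_funsD[OF that(2)]
        by (meson finite_UnI finite_subset)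
    qed simp
    show "mat_op V M (\<lambda>u\<in>V. a * p u + b * q u) = restrict (scale a h + scale b k) V"
      by (rule vertex_funs_eqI[of _ V]) (auto simp: mat_op_linear that scale_def)
  qed
  have "subspace S"
  proof (rule subspaceI)
    have "(\<lambda>u\<in>V. 0) \<in> fin_vertex_funs V"
      by (rule fin_vertex_funsI) (auto intro: finite_subset[of _ "{}"])
    moreover have "mat_op V M (\<lambda>u\<in>V. 0) = restrict 0 V"
      by (rule vertex_funs_eqI[of _ V]) (auto simp: mat_op_row_sum)
    ultimately show "0 \<in> S"
      unfolding S_def by blast
    show "x + y \<in> S" if xy: "x \<in> S" "y \<in> S" for x y
    proof -
      have "scale 1 x + scale 1 y = x + y"
        by (simp add: scale_def fun_eq_iff)
      then show ?thesis
        using comb[of _ _ x y 1 1] xy unfolding S_def by auto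
    qed
    show "scale c x \<in> S" if x: "x \<in> S" for c x
    proof -
      have "scale c x + scale 0 x = scale c x"
        by (simp add: scale_def fun_eq_iff)
      then show ?thesis
        using comb[of _ _ x x c 0] x unfolding S_def by auto
    qed
  qed
  moreover have "e w \<notin> S"
    using no_preimage by (auto simp: S_def delta_fun_def e_def)
  ultimately obtain \<phi> where lin: "Vector_Spaces.linear scale (*) \<phi>"
    and \<phi>_S: "\<And>h. h \<in> S \<Longrightarrow> \<phi> h = 0" and \<phi>_w: "\<phi> (e w) = 1"
    by (rule separating_functional) (rule that)
  interpret \<phi>: Vector_Spaces.linear scale "(*)" \<phi>
    by (fact lin)
  have "mat_op V M (\<lambda>u\<in>V. \<phi> (e u)) v = 0" if v: "v \<in> V" for v
  proof -
    let ?R = "{u \<in> V. M (v, u) \<noteq> 0}"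
    let ?h = "\<Sum>u\<in>?R. scale (M (v, u)) (e u)"
    have h: "?h u = M (u, v)" if "u \<in> V" for u
    proof -
      have "?h u = (\<Sum>u'\<in>?R. scale (M (v, u')) (e u') u)"
        by (rule fun_sum_apply)
      also have "\<dots> = (\<Sum>u'\<in>?R. if u' = u then M (v, u) else 0)"
        by (rule sum.cong) (auto simp: scale_def e_def)
      also have "\<dots> = M (v, u)"
        using row_finite[OF v] that by (simp add: sum.delta)
      finally show ?thesis
        using M_sym[OF that v] by simp
    qed
    have "mat_op V M (delta_fun V v) = restrict ?h V"
    proof (rule vertex_funs_eqI[of _ V])
      fix u assume u: "u \<in> V"
      have "mat_op V M (delta_fun V v) u = M (u, v)"
        using u v by (subst mat_op_eq_sum[of _ "{v}"]) (auto simp: delta_fun_def)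
      then show "mat_op V M (delta_fun V v) u = restrict ?h V u"
        using h u by simp
    qed simp_all
    then have "?h \<in> S"
      unfolding S_def by (intro CollectI bexI[OF _ delta_fun_fin])
    then have "0 = \<phi> ?h"
      by (rule \<phi>_S[symmetric])
    also have "\<dots> = (\<Sum>u\<in>?R. M (v, u) * \<phi> (e u))"
      by (simp only: \<phi>.sum \<phi>.scale)
    also have "\<dots> = mat_op V M (\<lambda>u\<in>V. \<phi> (e u)) v"
      unfolding mat_op_row_sum[OF v] by (rule sum.cong) simp_all
    finally show ?thesis
      by (rule sym)
  qed
  then have "\<forall>v\<in>V. (\<lambda>u\<in>V. \<phi> (e u)) v = 0"
    using inj[OF restrict_in_vertex_funs[of "\<lambda>u. \<phi> (e u)"]] by blast
  then have "\<phi> (e w) = 0"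
    using \<open>w \<in> V\<close> by simp
  with \<phi>_w show False
    by simp
qed

text \<open>
  A discrete Green's function with finitely supported sections: \<open>p v\<close> is column \<open>v\<close> of a
  column-finite right inverse of \<open>M\<close>.
\<close>

definition fin_green :: "('v \<Rightarrow> 'v \<Rightarrow> 'f) \<Rightarrow> bool" where
  "fin_green p \<longleftrightarrow> (\<forall>v\<in>V. p v \<in> fin_vertex_funs V \<and> mat_op V M (p v) = delta_fun V v)"

text \<open>
  Pair \<open>f\<close> with \<open>\<delta>\<^sub>u = M p\<^sub>u\<close> and move \<open>M\<close> to the other side. Here \<open>f\<close> is arbitrary, so the
  right inverse on finitely supported functions is a left inverse on all functions.
\<close>

lemma fin_green_recover:
  assumes "fin_green p" and "u \<in> V"
  shows "f u = pairing V (mat_op V M f) (p u)"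
  using assms pairing_mat_op[of "p u" f] pairing_delta_fun[of u V f] by (simp add: fin_green_def)

lemma fin_green_inj:
  assumes "fin_green p"
  shows "inj_on (mat_op V M) (vertex_funs V)"
proof (rule inj_onI)
  fix f g assume fg: "f \<in> vertex_funs V" "g \<in> vertex_funs V" and op: "mat_op V M f = mat_op V M g"
  have "f u = g u" if "u \<in> V" for u
    using fin_green_recover[OF assms that, of f] fin_green_recover[OF assms that, of g]
    unfolding op by (rule trans[OF _ sym])
  with fg show "f = g"
    by (intro vertex_funs_eqI[of f V g])
qed

text \<open>Reconstruct the function \<open>p u\<close>, whose image is \<open>\<delta>\<^sub>u\<close>, at the point \<open>v\<close>.\<close>

lemma fin_green_sym:
  assumes "fin_green p" and "u \<in> V" and "v \<in> V"
  shows "p u v = p v u"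
proof -
  have "p u v = pairing V (delta_fun V u) (p v)"
    using fin_green_recover[OF assms(1,3), of "p u"] assms(1,2) unfolding fin_green_def by metis
  then show ?thesis
    using assms(2) by (simp add: pairing_commute[of V "delta_fun V u"] pairing_delta_fun)
qed

text \<open>
  By \<open>p\<^sub>u w = p\<^sub>w u\<close>, row \<open>v\<close> applied to \<open>u \<mapsto> \<langle>g, p\<^sub>u\<rangle>\<close> turns into the sum over \<open>w\<close> of \<open>g w\<close> times
  row \<open>v\<close> applied to \<open>p\<^sub>w\<close>, that is, times \<open>\<delta>\<^sub>w v\<close>.
\<close>

lemma fin_green_solution:
  assumes p: "fin_green p" and g: "g \<in> vertex_funs V"
  shows "mat_op V M (\<lambda>v\<in>V. pairing V g (p v)) = g"
proof (rule vertex_funs_eqI[OF _ g])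
  fix v assume v: "v \<in> V"
  let ?R = "{u \<in> V. M (v, u) \<noteq> 0}"
  (* A finite set carrying the supports of all p u in row v; it must also contain v itself, the
     one index where the final sum is nonzero. *)
  let ?W = "insert v (\<Union>u\<in>?R. {w \<in> V. p u w \<noteq> 0})"
  have R: "finite ?R"
    using row_finite[OF v] .
  have W: "finite ?W"
    using R p by (auto simp: fin_green_def fin_vertex_funsD)
  have "mat_op V M (\<lambda>v\<in>V. pairing V g (p v)) v = (\<Sum>u\<in>?R. M (v, u) * pairing V g (p u))"
    using v by (simp add: mat_op_row_sum)
  also have "\<dots> = (\<Sum>u\<in>?R. \<Sum>w\<in>?W. g w * (M (v, u) * p w u))"
  proof (rule sum.cong[OF refl])
    fix u assume u: "u \<in> ?R"
    have "pairing V g (p u) = (\<Sum>w\<in>?W. g w * p u w)"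
      unfolding pairing_def using W u v by (intro supp_sum_eq_sum) auto
    also have "\<dots> = (\<Sum>w\<in>?W. g w * p w u)"
    proof (rule sum.cong[OF refl])
      fix w assume "w \<in> ?W"
      then have "w \<in> V"
        using v by auto
      then show "g w * p u w = g w * p w u"
        using fin_green_sym[OF p, of u w] u by simp
    qed
    finally show "M (v, u) * pairing V g (p u) = (\<Sum>w\<in>?W. g w * (M (v, u) * p w u))"
      by (simp add: sum_distrib_left mult.left_commute)
  qed
  also have "\<dots> = (\<Sum>w\<in>?W. g w * mat_op V M (p w) v)"
    by (subst sum.swap) (simp add: mat_op_row_sum v sum_distrib_left)
  also have "\<dots> = (\<Sum>w\<in>?W. if w = v then g v else 0)"
  proof (rule sum.cong[OF refl])
    fix w assume "w \<in> ?W"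
    then have "w \<in> V"
      using v by auto
    then show "g w * mat_op V M (p w) v = (if w = v then g v else 0)"
      using p v by (auto simp: fin_green_def delta_fun_def)
  qed
  also have "\<dots> = g v"
    using W by simp
  finally show "mat_op V M (\<lambda>v\<in>V. pairing V g (p v)) v = g v" .
qed simp

text \<open>
  The solution can be nonzero at \<open>v\<close> only if \<open>p\<^sub>v w = p\<^sub>w v\<close> is nonzero for some \<open>w\<close> in the support
  of \<open>g\<close>, and finitely many finite supports cover all such \<open>v\<close>.
\<close>

lemma fin_green_solution_fin:
  assumes p: "fin_green p" and g: "g \<in> fin_vertex_funs V"
  shows "(\<lambda>v\<in>V. pairing V g (p v)) \<in> fin_vertex_funs V"
proof (rule fin_vertex_funsI)
  let ?W = "{w \<in> V. g w \<noteq> 0}"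
  have "{v \<in> V. pairing V g (p v) \<noteq> 0} \<subseteq> (\<Union>w\<in>?W. {v \<in> V. p w v \<noteq> 0})"
  proof
    fix v assume v: "v \<in> {v \<in> V. pairing V g (p v) \<noteq> 0}"
    then have "support_on V (\<lambda>w. g w * p v w) \<noteq> {}"
      by (auto simp: pairing_def supp_sum_def)
    then obtain w where w: "w \<in> V" "g w \<noteq> 0" "p v w \<noteq> 0"
      by (auto simp: support_on_def)
    then have "p w v \<noteq> 0"
      using v fin_green_sym[OF p, of w v] by simp
    with v w show "v \<in> (\<Union>w\<in>?W. {v \<in> V. p w v \<noteq> 0})"
      by blast
  qed
  moreover have "finite (\<Union>w\<in>?W. {v \<in> V. p w v \<noteq> 0})"
    using p fin_vertex_funsD[OF g] by (auto simp: fin_green_def fin_vertex_funsD)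
  ultimately have "finite {v \<in> V. pairing V g (p v) \<noteq> 0}"
    by (rule finite_subset)
  then show "finite {v \<in> V. (\<lambda>v\<in>V. pairing V g (p v)) v \<noteq> 0}"
    by (rule rev_finite_subset) auto
qed simp

lemma fin_green_bij:
  assumes p: "fin_green p"
  shows "bij_betw (mat_op V M) (vertex_funs V) (vertex_funs V)"
proof (rule bij_betw_imageI)
  show "mat_op V M ` vertex_funs V = vertex_funs V"
  proof (intro subset_antisym subsetI)
    fix g :: "'v \<Rightarrow> 'f" assume "g \<in> vertex_funs V"
    then show "g \<in> mat_op V M ` vertex_funs V"
      using fin_green_solution[OF p] restrict_in_vertex_funs by (metis imageI)
  qed auto
qed (rule fin_green_inj[OF p])

lemma fin_green_bij_fin:
  assumes p: "fin_green p"
  shows "bij_betw (mat_op V M) (fin_vertex_funs V) (fin_vertex_funs V)"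
proof (rule bij_betw_imageI)
  show "inj_on (mat_op V M) (fin_vertex_funs V)"
    using fin_green_inj[OF p] by (rule inj_on_subset) (auto dest: fin_vertex_funs_subset)
  show "mat_op V M ` fin_vertex_funs V = fin_vertex_funs V"
  proof (intro subset_antisym subsetI)
    fix g :: "'v \<Rightarrow> 'f" assume g: "g \<in> fin_vertex_funs V"
    then show "g \<in> mat_op V M ` fin_vertex_funs V"
      using fin_green_solution[OF p fin_vertex_funs_subset[OF g]] fin_green_solution_fin[OF p g]
      by (metis imageI)
  qed (auto intro: mat_op_fin)
qed

lemma fin_green_ex_iff_inj:
  "(\<exists>p. fin_green p) \<longleftrightarrow> inj_on (mat_op V M) (vertex_funs V)"
proof
  assume inj: "inj_on (mat_op V M) (vertex_funs V)"
  have "\<exists>q. q \<in> fin_vertex_funs V \<and> mat_op V M q = delta_fun V v" if "v \<in> V" for v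
  proof -
    have "\<forall>v\<in>V. f v = 0" if f: "f \<in> vertex_funs V" "\<forall>v\<in>V. mat_op V M f v = 0" for f
    proof -
      have "mat_op V M f = mat_op V M (\<lambda>u\<in>V. 0)"
        using f by (intro vertex_funs_eqI[of _ V]) (auto simp: mat_op_row_sum)
      then have "f = (\<lambda>u\<in>V. 0)"
        using inj f(1) by (auto dest: inj_onD)
      then show ?thesis
        by simp
    qed
    then show ?thesis
      using delta_fun_in_image[OF _ that] by metis
  qed
  then show "\<exists>p. fin_green p"
    unfolding fin_green_def by metis
qed (auto intro: fin_green_inj)

text \<open>Adding a difference \<open>f - g\<close> from the kernel to \<open>p\<close> does not change its image.\<close>

lemma inj_of_unique_preimage:
  assumes p: "p \<in> vertex_funs V"
    and unique: "\<And>q. q \<in> vertex_funs V \<Longrightarrow> mat_op V M q = mat_op V M p \<Longrightarrow> q = p"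
  shows "inj_on (mat_op V M) (vertex_funs V)"
proof (rule inj_onI)
  fix f g assume fg: "f \<in> vertex_funs V" "g \<in> vertex_funs V" "mat_op V M f = mat_op V M g"
  let ?d = "\<lambda>u\<in>V. 1 * f u + (-1) * g u"
  let ?q = "\<lambda>u\<in>V. 1 * p u + 1 * ?d u"
  have "mat_op V M ?q v = mat_op V M p v" if "v \<in> V" for v
    using fg(3) that by (simp only: mat_op_linear) simp
  then have "?q = p"
    by (intro unique vertex_funs_eqI[of "mat_op V M ?q" V]) simp_all
  have "f v = g v" if "v \<in> V" for v
    using fun_cong[OF \<open>?q = p\<close>, of v] that by simp
  then show "f = g"
    using fg by (intro vertex_funs_eqI[of _ V]) auto
qed

text \<open>
  \<open>M B = E\<close> says that the columns of \<open>B\<close> are preimages of the unit vectors. Conversely, such columns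
  form a symmetric matrix by \<open>fin_green_sym\<close>, so column finiteness implies row finiteness, and
  \<open>B M = E\<close> follows by transposing \<open>M B = E\<close>.
\<close>

lemma rcf_inverse_iff_fin_green:
  assumes "M \<in> V \<times> V \<rightarrow>\<^sub>E UNIV"
  shows "rcf_inverse V M B \<longleftrightarrow>
    B \<in> V \<times> V \<rightarrow>\<^sub>E UNIV \<and> fin_green (\<lambda>w. \<lambda>v\<in>V. B (v, w))"
proof -
  let ?p = "\<lambda>w. \<lambda>v\<in>V. B (v, w)"
  have M: "M \<in> rcf_mats V"
    using assms row_finite M_sym by (auto simp: rcf_mats_def cong: conj_cong)
  have MB: "mat_mul V M B (u, w) = mat_op V M (?p w) u" if "u \<in> V" "w \<in> V" for u w
    using that by (auto simp: mat_mul_def mat_op_def intro!: supp_sum_cong)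
  have mat_eqI: "A = C" if "A \<in> V \<times> V \<rightarrow>\<^sub>E UNIV" "C \<in> V \<times> V \<rightarrow>\<^sub>E UNIV"
    "\<And>u w. u \<in> V \<Longrightarrow> w \<in> V \<Longrightarrow> A (u, w) = C (u, w)" for A C :: "'v \<times> 'v \<Rightarrow> 'f"
    using that by (intro PiE_ext[of A "V \<times> V" "\<lambda>_. UNIV" C]) auto
  have ext: "mat_mul V A C \<in> V \<times> V \<rightarrow>\<^sub>E UNIV" "mat_id V \<in> V \<times> V \<rightarrow>\<^sub>E (UNIV :: 'f set)"
    for A C :: "'v \<times> 'v \<Rightarrow> 'f"
    by (auto simp: mat_mul_def mat_id_def)
  show ?thesis
  proof
    assume inv: "rcf_inverse V M B"
    then have B: "B \<in> rcf_mats V" and MB_id: "mat_mul V M B = mat_id V"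
      by (auto simp: rcf_inverse_def)
    have "fin_green ?p"
      unfolding fin_green_def
    proof (intro ballI conjI)
      fix w assume w: "w \<in> V"
      show "?p w \<in> fin_vertex_funs V"
        using B w by (intro fin_vertex_funsI) (auto simp: rcf_mats_def cong: conj_cong)
      show "mat_op V M (?p w) = delta_fun V w"
      proof (rule vertex_funs_eqI[of _ V])
        fix u assume "u \<in> V"
        then show "mat_op V M (?p w) u = delta_fun V w u"
          using MB[OF _ w, of u] MB_id w by (simp add: mat_id_def delta_fun_def)
      qed (simp_all add: fin_vertex_funs_subset)
    qed
    then show "B \<in> V \<times> V \<rightarrow>\<^sub>E UNIV \<and> fin_green ?p"
      using B by (simp add: rcf_mats_def)
  next
    assume "B \<in> V \<times> V \<rightarrow>\<^sub>E UNIV \<and> fin_green ?p"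
    then have B_ext: "B \<in> V \<times> V \<rightarrow>\<^sub>E UNIV" and p: "fin_green ?p"
      by auto
    have B_sym: "B (u, w) = B (w, u)" if "u \<in> V" "w \<in> V" for u w
      using fin_green_sym[OF p that(2,1)] that by simp
    have col: "finite {u \<in> V. B (u, w) \<noteq> 0}" if "w \<in> V" for w
    proof -
      have "finite {u \<in> V. ?p w u \<noteq> 0}"
        using p that by (auto simp only: fin_green_def fin_vertex_funsD)
      then show ?thesis
        by (rule rev_finite_subset) auto
    qed
    then have B: "B \<in> rcf_mats V"
      using B_ext B_sym by (auto simp: rcf_mats_def cong: conj_cong)
    have MB_id: "mat_mul V M B = mat_id V"
    proof (rule mat_eqI)
      fix u w assume "u \<in> V" "w \<in> V"
      then show "mat_mul V M B (u, w) = mat_id V (u, w)"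
        using p by (simp add: MB fin_green_def mat_id_def delta_fun_def)
    qed (rule ext)+
    have "mat_mul V B M = mat_id V"
    proof (rule mat_eqI)
      fix u w assume uw: "u \<in> V" "w \<in> V"
      have "mat_mul V B M (u, w) = mat_mul V M B (w, u)"
        using uw by (auto simp: mat_mul_def B_sym M_sym mult.commute intro!: supp_sum_cong)
      then show "mat_mul V B M (u, w) = mat_id V (u, w)"
        using uw by (auto simp: MB_id mat_id_def)
    qed (rule ext)+
    then show "rcf_inverse V M B"
      using M B MB_id by (simp add: rcf_inverse_def)
  qed
qed

end

section \<open>The adjacency operator\<close>

lemma adj_mat_minus_symmetric_row_finite:
  assumes "locally_finite_graph G"
  shows "symmetric_row_finite (pverts G) (adj_mat_minus G lam)"
proof
  fix v assume v: "v \<in> pverts G"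
  have "{u \<in> pverts G. adj_mat_minus G lam (v, u) \<noteq> 0} \<subseteq> insert v (neighbours G v)"
    using v by (auto simp: adj_mat_minus_def adj_mat_def mat_id_def neighbours_def split: if_splits)
  then show "finite {u \<in> pverts G. adj_mat_minus G lam (v, u) \<noteq> 0}"
    using assms v by (meson finite_insert finite_subset locally_finite_graph_def)
next
  fix u v assume "u \<in> pverts G" "v \<in> pverts G"
  moreover have "(u, v) \<in> parcs G \<longleftrightarrow> (v, u) \<in> parcs G"
  proof -
    interpret pair_bidirected_digraph G
      using assms by (simp add: locally_finite_graph_def)
    show ?thesis
      using sym_arcs by (auto simp: symmetric_def dest: symD)
  qed
  ultimately show "adj_mat_minus G lam (u, v) = adj_mat_minus G lam (v, u)"
    by (auto simp: adj_mat_minus_def adj_mat_def mat_id_def)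
qed

lemma adj_op_minus_eq_mat_op:
  assumes "locally_finite_graph G"
  shows "adj_op_minus G lam f = mat_op (pverts G) (adj_mat_minus G lam) f"
proof (rule vertex_funs_eqI[of _ "pverts G"])
  fix v assume v: "v \<in> pverts G"
  interpret pair_bidirected_digraph G
    using assms by (simp add: locally_finite_graph_def)
  let ?N = "neighbours G v"
  have fin: "finite ?N"
    using assms v by (simp add: locally_finite_graph_def)
  have sub: "?N \<subseteq> pverts G" and irr: "v \<notin> ?N"
    using no_loops' by (auto simp: neighbours_def dest: in_arcsD2)
  have "mat_op (pverts G) (adj_mat_minus G lam) f v =
      (\<Sum>u\<in>insert v ?N. adj_mat_minus G lam (v, u) * f u)"
    unfolding mat_op_def using v fin sub
    by (simp only: restrict_apply' , intro supp_sum_eq_sum)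
      (auto simp: adj_mat_minus_def adj_mat_def mat_id_def neighbours_def)
  also have "\<dots> = - lam * f v + (\<Sum>u\<in>?N. f u)"
    using fin irr v sub
    by (subst sum.insert)
      (auto simp: adj_mat_minus_def adj_mat_def mat_id_def neighbours_def intro!: sum.cong)
  finally show "adj_op_minus G lam f v = mat_op (pverts G) (adj_mat_minus G lam) f v"
    using v by (simp add: adj_op_minus_def adj_op_def)
qed (simp_all add: adj_op_minus_def)

lemma not_adj_eigenvalue_iff_inj:
  assumes "locally_finite_graph G"
  shows "\<not> adj_eigenvalue G lam \<longleftrightarrow> inj_on (adj_op_minus G lam) (vertex_funs (pverts G))"
proof -
  let ?V = "pverts G"
  interpret symmetric_row_finite ?V "adj_mat_minus G lam"
    by (rule adj_mat_minus_symmetric_row_finite[OF assms])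
  have zero: "adj_op_minus G lam (\<lambda>v\<in>?V. 0) = (\<lambda>v\<in>?V. 0)"
    by (rule vertex_funs_eqI[of _ ?V])
      (auto simp: adj_op_minus_eq_mat_op[OF assms] mat_op_row_sum)
  have eigen: "adj_op G f = (\<lambda>v\<in>?V. lam * f v) \<longleftrightarrow> adj_op_minus G lam f = (\<lambda>v\<in>?V. 0)" for f
    by (auto simp: adj_op_minus_def adj_op_def restrict_def fun_eq_iff)
  show ?thesis
  proof
    assume "\<not> adj_eigenvalue G lam"
    then show "inj_on (adj_op_minus G lam) (vertex_funs ?V)"
      using inj_of_unique_preimage[of "\<lambda>v\<in>?V. 0"] zero
      by (simp add: adj_eigenvalue_def eigen adj_op_minus_eq_mat_op[OF assms] inj_on_def) metis
  next
    assume "inj_on (adj_op_minus G lam) (vertex_funs ?V)"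
    then show "\<not> adj_eigenvalue G lam"
      unfolding adj_eigenvalue_def eigen using zero by (metis inj_onD restrict_in_vertex_funs)
  qed
qed

theorem mainTheorem4:
  fixes G :: "'v pair_pre_digraph"
    and av :: "'f::field \<Rightarrow> real"
    and lam :: 'f
  assumes "locally_finite_graph G"
    and "absolute_value av"
  defines "V \<equiv> pverts G"
    and "T \<equiv> adj_op_minus G lam"
  shows
    "(\<not> adj_eigenvalue G lam \<longleftrightarrow> inj_on T (vertex_funs V)) \<and>
     (\<not> adj_eigenvalue G lam \<longleftrightarrow> bij_betw T (vertex_funs V) (vertex_funs V)) \<and>
     (\<not> adj_eigenvalue G lam \<longleftrightarrow> (\<exists>v\<in>V. \<exists>!p. propagator G lam v p)) \<and>
     (\<not> adj_eigenvalue G lam \<longleftrightarrow> fin_propagator_verts G lam = V) \<and>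
     (\<not> adj_eigenvalue G lam \<longleftrightarrow>
        (\<exists>p. (\<forall>v\<in>V. propagator G lam v (p v) \<and> (\<forall>q. propagator G lam v q \<longrightarrow> q = p v) \<and>
                     finite (support_on V (p v))) \<and>
             (\<forall>v1\<in>V. \<forall>v2\<in>V. p v1 v2 = p v2 v1) \<and>
             (\<forall>v\<in>V. finite {u \<in> V. v \<in> support_on V (p u)}))) \<and>
     (\<not> adj_eigenvalue G lam \<longleftrightarrow>
        (\<exists>B. rcf_inverse V (adj_mat_minus G lam) B \<and> symmetric_mat V B)) \<and>
     (\<forall>B. rcf_inverse V (adj_mat_minus G lam) B \<longrightarrow> symmetric_mat V B) \<and>
     (\<not> adj_eigenvalue G lam \<longleftrightarrow> T ` fin_vertex_funs V = fin_vertex_funs V) \<and>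
     (\<not> adj_eigenvalue G lam \<longleftrightarrow> bij_betw T (fin_vertex_funs V) (fin_vertex_funs V))"
proof -
  let ?M = "adj_mat_minus G lam"
  interpret symmetric_row_finite V ?M
    unfolding V_def by (rule adj_mat_minus_symmetric_row_finite[OF assms(1)])
  have T: "T = mat_op V ?M"
    by (simp add: T_def V_def adj_op_minus_eq_mat_op[OF assms(1)] fun_eq_iff)
  have prop_iff: "propagator G lam v f \<longleftrightarrow> f \<in> vertex_funs V \<and> mat_op V ?M f = delta_fun V v" for v f
    using T by (simp add: propagator_def V_def T_def)
  have fin_prop_iff: "propagator G lam v f \<and> finite (support_on V f) \<longleftrightarrow>
      f \<in> fin_vertex_funs V \<and> mat_op V ?M f = delta_fun V v" for v f
    by (auto simp: prop_iff fin_vertex_funs_def)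
  have V_nonempty: "V \<noteq> {}"
    using assms(1) by (simp add: V_def locally_finite_graph_def)
  have M_ext: "?M \<in> V \<times> V \<rightarrow>\<^sub>E UNIV"
    by (simp add: adj_mat_minus_def V_def)
  have i: "\<not> adj_eigenvalue G lam \<longleftrightarrow> (\<exists>p. fin_green p)"
    using not_adj_eigenvalue_iff_inj[OF assms(1), of lam, folded V_def T_def]
    unfolding T fin_green_ex_iff_inj .
  have inj: "inj_on T (vertex_funs V) \<longleftrightarrow> (\<exists>p. fin_green p)"
    by (simp add: T fin_green_ex_iff_inj)
  have ii: "bij_betw T (vertex_funs V) (vertex_funs V) \<longleftrightarrow> (\<exists>p. fin_green p)"
    using fin_green_bij fin_green_ex_iff_inj by (auto simp: T bij_betw_def)
  have v: "(\<exists>p. fin_green p) \<longleftrightarrow>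
      (\<exists>p. (\<forall>v\<in>V. propagator G lam v (p v) \<and> (\<forall>q. propagator G lam v q \<longrightarrow> q = p v) \<and>
                   finite (support_on V (p v))) \<and>
           (\<forall>v1\<in>V. \<forall>v2\<in>V. p v1 v2 = p v2 v1) \<and>
           (\<forall>v\<in>V. finite {u \<in> V. v \<in> support_on V (p u)}))" (is "_ \<longleftrightarrow> (\<exists>p. ?v p)")
  proof
    assume "\<exists>p. fin_green p"
    then obtain p where p: "fin_green p" ..
    have pv: "propagator G lam v (p v)" "finite (support_on V (p v))" if "v \<in> V" for v
      using p that fin_prop_iff by (auto simp: fin_green_def)
    have unique: "q = p v" if "v \<in> V" "propagator G lam v q" for v q
      using inj_onD[OF fin_green_inj[OF p], of q "p v"] that pv(1)[OF that(1)]
      by (simp add: prop_iff)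
    have dual_fin: "finite {u \<in> V. v \<in> support_on V (p u)}" if "v \<in> V" for v
    proof -
      have "{u \<in> V. v \<in> support_on V (p u)} = support_on V (p v)"
        using fin_green_sym[OF p] that by (auto simp: support_on_def)
      then show ?thesis
        using pv(2)[OF that] by simp
    qed
    show "\<exists>p. ?v p"
    proof (rule exI[where x = p])
      show "?v p"
        by (intro conjI ballI allI impI; (fact pv(1) | fact pv(2) | fact unique | fact dual_fin
              | rule fin_green_sym[OF p]; assumption))
    qed
  next
    assume "\<exists>p. ?v p"
    then obtain p where "\<forall>v\<in>V. propagator G lam v (p v) \<and> finite (support_on V (p v))"
      by auto
    then show "\<exists>p. fin_green p"
      unfolding fin_green_def fin_prop_iff by auto
  qed
  have iii: "(\<exists>v\<in>V. \<exists>!p. propagator G lam v p) \<longleftrightarrow> (\<exists>p. fin_green p)"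
  proof
    assume "\<exists>v\<in>V. \<exists>!p. propagator G lam v p"
    then show "\<exists>p. fin_green p"
      unfolding fin_green_ex_iff_inj prop_iff
    proof (elim bexE ex1E conjE)
      fix v p
      assume p: "p \<in> vertex_funs V" "mat_op V ?M p = delta_fun V v"
        and unique: "\<forall>q. q \<in> vertex_funs V \<and> mat_op V ?M q = delta_fun V v \<longrightarrow> q = p"
      show "inj_on (mat_op V ?M) (vertex_funs V)"
        using p(1)
      proof (rule inj_of_unique_preimage)
        fix q assume "q \<in> vertex_funs V" "mat_op V ?M q = mat_op V ?M p"
        then show "q = p"
          unfolding p(2) by (intro unique[rule_format] conjI)
      qed
    qed
  next
    assume "\<exists>p. fin_green p"
    then obtain p where p: "fin_green p" ..
    obtain w where w: "w \<in> V"
      using V_nonempty by auto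
    have pw: "p w \<in> vertex_funs V" "mat_op V ?M (p w) = delta_fun V w"
      using p w by (simp_all add: fin_green_def fin_vertex_funs_subset)
    have "\<exists>!q. propagator G lam w q"
      unfolding prop_iff
    proof (rule ex1I[of _ "p w"])
      fix q assume "q \<in> vertex_funs V \<and> mat_op V ?M q = delta_fun V w"
      then show "q = p w"
        using inj_onD[OF fin_green_inj[OF p], of q "p w"] pw by simp
    qed (use pw in simp)
    then show "\<exists>v\<in>V. \<exists>!p. propagator G lam v p"
      using w by (rule bexI)
  qed
  have iv: "fin_propagator_verts G lam = V \<longleftrightarrow> (\<exists>p. fin_green p)"
  proof -
    have "fin_propagator_verts G lam = V \<longleftrightarrow>
        (\<forall>v\<in>V. \<exists>f. f \<in> fin_vertex_funs V \<and> mat_op V ?M f = delta_fun V v)"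
      unfolding fin_propagator_verts_def V_def[symmetric] fin_prop_iff by blast
    also have "\<dots> \<longleftrightarrow> (\<exists>p. fin_green p)"
      unfolding fin_green_def by (rule bchoice_iff)
    finally show ?thesis .
  qed
  have vi_sym: "symmetric_mat V B" if "rcf_inverse V ?M B" for B
    unfolding symmetric_mat_def
  proof (intro ballI)
    fix u v assume "u \<in> V" "v \<in> V"
    then show "B (u, v) = B (v, u)"
      using that fin_green_sym[of "\<lambda>w. \<lambda>v\<in>V. B (v, w)" v u]
      by (simp add: rcf_inverse_iff_fin_green[OF M_ext])
  qed
  have vi: "(\<exists>B. rcf_inverse V ?M B \<and> symmetric_mat V B) \<longleftrightarrow> (\<exists>p. fin_green p)"
  proof
    assume "\<exists>p. fin_green p"
    then obtain p where p: "fin_green p" ..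
    let ?B = "\<lambda>(v, w)\<in>V \<times> V. p w v"
    have "(\<lambda>v\<in>V. ?B (v, w)) = p w" if "w \<in> V" for w
      using p that by (intro vertex_funs_eqI[of _ V]) (auto simp: fin_green_def fin_vertex_funs_subset)
    then have "fin_green (\<lambda>w. \<lambda>v\<in>V. ?B (v, w))"
      using p unfolding fin_green_def by simp
    then have "rcf_inverse V ?M ?B"
      by (simp add: rcf_inverse_iff_fin_green[OF M_ext])
    then show "\<exists>B. rcf_inverse V ?M B \<and> symmetric_mat V B"
      using vi_sym by blast
  next
    assume "\<exists>B. rcf_inverse V ?M B \<and> symmetric_mat V B"
    then show "\<exists>p. fin_green p"
      unfolding rcf_inverse_iff_fin_green[OF M_ext] by (elim exE conjE) (rule exI)
  qed
  have vii: "T ` fin_vertex_funs V = fin_vertex_funs V \<longleftrightarrow> (\<exists>p. fin_green p)"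
  proof
    assume onto: "T ` fin_vertex_funs V = fin_vertex_funs V"
    have "\<forall>v\<in>V. \<exists>f. f \<in> fin_vertex_funs V \<and> mat_op V ?M f = delta_fun V v"
      using onto delta_fun_fin unfolding T by (metis imageE)
    then show "\<exists>p. fin_green p"
      unfolding fin_green_def by (rule bchoice)
  qed (use fin_green_bij_fin in \<open>auto simp: T bij_betw_def\<close>)
  have viii: "bij_betw T (fin_vertex_funs V) (fin_vertex_funs V) \<longleftrightarrow> (\<exists>p. fin_green p)"
    using fin_green_bij_fin vii by (auto simp: T bij_betw_def)
  show ?thesis
    unfolding i inj ii iii iv v[symmetric] vi vii viii using vi_sym by simp
qed

end
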